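(* Let $X$ be an absolutely continuous random variable with pdf $f$ and cdf $F$, and let $w_1\ge 0$ be a weight function. Let $p\in(0,\tfrac12)\cup(\tfrac12,1)$, $q=1-p$, $a=[p(n+1)]$, $b=[q(n+1)]$. For $n$ even, $$\frac{J^{w_1}(\mathbf{X}_{PRSS}^{(n)})}{J^{w_1}(\mathbf{X}_{SRS}^{(n)})}\le \frac{n^{2n}}{(n-1)^{2n(n-1)}}\left(\prod_{i=1}^{\frac n2}\binom{n-1}{a-1}^{2}(a-1)^{2a-2}(n-a)^{2n-2a}\right)\left(\prod_{i=\frac n2+1}^{n}\binom{n-1}{b-1}^{2}(b-1)^{2b-2}(n-b)^{2n-2b}\right),$$ and for $n$ odd, $$\frac{J^{w_1}(\mathbf{X}_{PRSS}^{(n)})}{J^{w_1}(\mathbf{X}_{SRS}^{(n)})}\le \frac{n^{2n-2}}{(n-1)^{2(n-1)^{2}}}\,\frac{(n!)^{2}}{\left(\left(\frac{n-1}{2}\right)!\right)^{4}}\left(\prod_{i=1}^{\frac{n-1}{2}}\binom{n-1}{a-1}^{2}(a-1)^{2a-2}(n-a)^{2n-2a}\right)\left(\prod_{i=\frac{n+1}{2}}^{n-1}\binom{n-1}{b-1}^{2}(b-1)^{2b-2}(n-b)^{2n-2b}\right).$$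
   Context: $[\,\cdot\,]$ denotes rounding to the nearest integer. The convention $0^0=1$ is used and empty products equal $1$. For $1\le i\le n$, the pdf of the $i$-th order statistic of a sample of size $n$ from $F$ is $$f_{i:n}(x)=\frac{n!}{(i-1)!(n-i)!}F(x)^{i-1}(1-F(x))^{n-i}f(x).$$ The general weighted extropy (GWE) of $X$ with weight $w_1$ is $J^{w_1}(X)=-\frac12\int_{-\infty}^{\infty}w_1(x)f(x)^2\,dx$. The GWE of a simple random sample of size $n$ is $$J^{w_1}(\mathbf{X}_{SRS}^{(n)})=-\tfrac12\left(\int_{-\infty}^{\infty}w_1(x)f(x)^2\,dx\right)^{n}.$$ The GWE of a percentile ranked set sample (PRSS) of size $n$ with percentile $p$ is, for $n$ even, $$J^{w_1}(\mathbf{X}_{PRSS}^{(n)})=-\tfrac12\left(\int_{-\infty}^{\infty} w_1(x)f_{a:n}(x)^2dx\right)^{n/2}\left(\int_{-\infty}^{\infty} w_1(x)f_{b:n}(x)^2dx\right)^{n/2},$$ and for $n$ odd, $$J^{w_1}(\mathbf{X}_{PRSS}^{(n)})=-\tfrac12\left(\int_{-\infty}^{\infty} w_1(x)f_{a:n}(x)^2dx\right)^{\frac{n-1}{2}}\left(\int_{-\infty}^{\infty} w_1(x)f_{b:n}(x)^2dx\right)^{\frac{n-1}{2}}\left(\int_{-\infty}^{\infty} w_1(x)f_{\frac{n+1}{2}:n}(x)^2dx\right).$$ It is assumed that $1\le a,b\le n$ whenever $a,b$ occur (i.e. $n\ge 2$), so that the order statistics are defined, and that $J^{w_1}(X)$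 is finite and nonzero, so that the ratio is defined. *)

theory Defs
  imports "HOL-Probability.Probability"
begin

definition order_stat_pdf :: "(real \<Rightarrow> real) \<Rightarrow> (real \<Rightarrow> real) \<Rightarrow> nat \<Rightarrow> nat \<Rightarrow> real \<Rightarrow> real" where
  "order_stat_pdf F f i n x =
     fact n / (fact (i - 1) * fact (n - i)) * F x ^ (i - 1) * (1 - F x) ^ (n - i) * f x"

text \<open>The integrals below are Bochner integrals, which are 0 by convention for non-integrable
  functions. So \<open>gwe\<close> is the general weighted extropy only if \<open>\<lambda>x. w x * (f x)\<^sup>2\<close> is integrable;
  the integrals with \<open>order_stat_pdf\<close> then exist as well, since \<open>F\<close> takes values in [0, 1].\<close>

definition gwe :: "(real \<Rightarrow> real) \<Rightarrow> (real \<Rightarrow> real) \<Rightarrow> real" where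
  "gwe w f = - (1/2) * (LINT x|lborel. w x * (f x)\<^sup>2)"

definition gwe_SRS :: "(real \<Rightarrow> real) \<Rightarrow> (real \<Rightarrow> real) \<Rightarrow> nat \<Rightarrow> real" where
  "gwe_SRS w f n = - (1/2) * (LINT x|lborel. w x * (f x)\<^sup>2) ^ n"

text \<open>The rank [p(n + 1)] of the p-th percentile; \<open>round\<close> rounds half-integers up.\<close>

definition percentile_rank :: "real \<Rightarrow> nat \<Rightarrow> nat" where
  "percentile_rank p n = nat (round (p * (real n + 1)))"

definition gwe_PRSS ::
  "(real \<Rightarrow> real) \<Rightarrow> (real \<Rightarrow> real) \<Rightarrow> (real \<Rightarrow> real) \<Rightarrow> real \<Rightarrow> nat \<Rightarrow> real" where
  "gwe_PRSS w F f p n =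
     (let I = (\<lambda>i. LINT x|lborel. w x * (order_stat_pdf F f i n x)\<^sup>2);
          a = percentile_rank p n;
          b = percentile_rank (1 - p) n
      in if even n
         then - (1/2) * I a ^ (n div 2) * I b ^ (n div 2)
         else - (1/2) * I a ^ ((n - 1) div 2) * I b ^ ((n - 1) div 2) * I ((n + 1) div 2))"

end

theory Submission
  imports Defs
begin

text \<open>
  The density of the \<open>i\<close>-th order statistic is \<open>f\<close> times the value at \<open>u = F x\<close> of the Beta density
  \<open>n * (n - 1 choose i - 1) * u ^ (i - 1) * (1 - u) ^ (n - i)\<close>. On the unit interval this polynomial
  is largest at \<open>u = (i - 1) / (n - 1)\<close> if \<open>n \<ge> 2\<close>, and constant if \<open>n = 1\<close>; call the maximum
  \<open>c\<close> (\<open>beta_peak n i\<close>). As the weight is nonnegative, the pointwise bound \<open>f\<^bsub>i:n\<^esub> \<le> c * f\<close> gives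
  \<open>\<integral> w * f\<^bsub>i:n\<^esub>\<^sup>2 \<le> c\<^sup>2 * \<integral> w * f\<^sup>2\<close> (\<open>integral_order_stat_le\<close>).

  The extropy of the percentile ranked set sample is a product of \<open>n\<close> such integrals (times \<open>-1/2\<close>)
  and that of the simple random sample is the product of \<open>n\<close> copies of \<open>\<integral> w * f\<^sup>2\<close>, so the quotient
  is at most the product of the constants \<open>c\<^sup>2\<close>. This product is the right-hand side, except that for
  odd \<open>n\<close> the median contributes only the squared multinomial coefficient
  \<open>(n! / (((n - 1) / 2)!)\<^sup>2)\<^sup>2\<close>: there \<open>u ^ (i - 1) * (1 - u) ^ (n - i)\<close> is estimated by \<open>1\<close>.
\<close>

text \<open>The tangent line inequality \<open>1 + t \<le> exp t\<close> at \<open>t = x / k - 1\<close>, raised to the power \<open>k\<close>.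
  The instances \<open>x = (k + l) * u\<close> with exponent \<open>k\<close> and \<open>x = (k + l) * (1 - u)\<close> with exponent \<open>l\<close>
  have exponential factors that cancel, which yields the maximum of \<open>u ^ k * (1 - u) ^ l\<close>.\<close>

lemma power_le_self_power_exp:
  fixes x :: real
  assumes "0 \<le> x"
  shows "x ^ k \<le> real k ^ k * exp (x - real k)"
proof (cases "k = 0")
  case False
  have "x / k \<le> exp (x / k - 1)"
    using exp_ge_add_one_self[of "x / k - 1"] by simp
  then have "(x / k) ^ k \<le> exp (x / k - 1) ^ k"
    using assms by (intro power_mono) auto
  also have "\<dots> = exp (x - k)"
    using False by (simp add: exp_of_nat_mult[symmetric] right_diff_distrib)
  finally show ?thesis
    using False by (simp add: power_divide field_simps)
qed (use assms in simp)

lemma beta_monomial_le: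
  fixes u :: real
  assumes "0 \<le> u" "u \<le> 1"
  shows "u ^ k * (1 - u) ^ l \<le> real k ^ k * real l ^ l / real (k + l) ^ (k + l)"
proof -
  let ?m = "real (k + l)"
  have "(?m * u) ^ k * (?m * (1 - u)) ^ l
      \<le> (real k ^ k * exp (?m * u - k)) * (real l ^ l * exp (?m * (1 - u) - l))"
    using assms by (intro mult_mono power_le_self_power_exp) auto
  also have "\<dots> = real k ^ k * real l ^ l * exp ((?m * u - k) + (?m * (1 - u) - l))"
    by (simp only: exp_add mult_ac)
  also have "(?m * u - k) + (?m * (1 - u) - l) = 0"
    by (simp add: algebra_simps)
  finally have "u ^ k * (1 - u) ^ l * ?m ^ (k + l) \<le> real k ^ k * real l ^ l"
    by (simp add: power_mult_distrib power_add mult_ac)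
  moreover have "0 < ?m ^ (k + l)"
    by (cases "k = 0 \<and> l = 0") (auto intro!: zero_less_power)
  ultimately show ?thesis
    by (simp add: pos_le_divide_eq)
qed

text \<open>The maximum over the unit interval of the Beta density with parameters \<open>i\<close> and \<open>n - i + 1\<close>, for
  \<open>1 \<le> i \<le> n\<close>.\<close>

definition beta_peak :: "nat \<Rightarrow> nat \<Rightarrow> real" where
  "beta_peak n i = real n * real ((n - 1) choose (i - 1))
     * (real (i - 1) ^ (i - 1) * real (n - i) ^ (n - i) / real (n - 1) ^ (n - 1))"

lemma order_stat_coeff:
  assumes "i \<in> {1..n}"
  shows "fact n / (fact (i - 1) * fact (n - i)) = real n * real ((n - 1) choose (i - 1))"
proof -
  have "real ((n - 1) choose (i - 1)) = fact (n - 1) / (fact (i - 1) * fact (n - 1 - (i - 1)))"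
    using assms by (intro binomial_fact) auto
  moreover have "n - 1 - (i - 1) = n - i"
    using assms by auto
  moreover have "fact n = real n * fact (n - 1)"
    using assms by (intro fact_reduce) auto
  ultimately show ?thesis
    by simp
qed

lemma order_stat_pdf_le:
  assumes "i \<in> {1..n}" "0 \<le> F x" "F x \<le> 1" "0 \<le> f x"
  shows "order_stat_pdf F f i n x \<le> beta_peak n i * f x"
proof -
  have sum: "i - 1 + (n - i) = n - 1"
    using assms by auto
  have "F x ^ (i - 1) * (1 - F x) ^ (n - i)
      \<le> real (i - 1) ^ (i - 1) * real (n - i) ^ (n - i) / real (n - 1) ^ (n - 1)"
    using beta_monomial_le[of "F x" "i - 1" "n - i"] assms(2,3) unfolding sum by blast
  then have "real n * real ((n - 1) choose (i - 1)) * (F x ^ (i - 1) * (1 - F x) ^ (n - i)) * f x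
      \<le> beta_peak n i * f x"
    unfolding beta_peak_def using assms(4) by (intro mult_right_mono mult_left_mono) auto
  then show ?thesis
    unfolding order_stat_pdf_def order_stat_coeff[OF assms(1)] by (simp only: mult.assoc)
qed

lemma order_stat_pdf_le_coeff:
  assumes "0 \<le> F x" "F x \<le> 1" "0 \<le> f x"
  shows "order_stat_pdf F f i n x \<le> fact n / (fact (i - 1) * fact (n - i)) * f x"
proof -
  have "F x ^ (i - 1) * (1 - F x) ^ (n - i) \<le> 1"
    using assms by (intro mult_le_one power_le_one) auto
  then have "fact n / (fact (i - 1) * fact (n - i)) * (F x ^ (i - 1) * (1 - F x) ^ (n - i)) * f x
      \<le> fact n / (fact (i - 1) * fact (n - i)) * 1 * f x"
    using assms(3) by (intro mult_right_mono mult_left_mono) auto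
  then show ?thesis
    unfolding order_stat_pdf_def by (simp only: mult.assoc mult_1_left)
qed

lemma order_stat_pdf_nonneg:
  assumes "0 \<le> F x" "F x \<le> 1" "0 \<le> f x"
  shows "0 \<le> order_stat_pdf F f i n x"
  unfolding order_stat_pdf_def using assms by simp

lemma integral_weighted_square_le:
  fixes w f g :: "'a \<Rightarrow> real"
  assumes "integrable N (\<lambda>x. w x * (f x)\<^sup>2)"
    and "\<And>x. 0 \<le> w x" "\<And>x. 0 \<le> g x" "\<And>x. g x \<le> c * f x"
  shows "(LINT x|N. w x * (g x)\<^sup>2) \<le> c\<^sup>2 * (LINT x|N. w x * (f x)\<^sup>2)"
proof -
  have "(g x)\<^sup>2 \<le> c\<^sup>2 * (f x)\<^sup>2" for x
    using power_mono[OF assms(4,3), of x 2] by (simp add: power_mult_distrib)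
  then have "w x * (g x)\<^sup>2 \<le> c\<^sup>2 * (w x * (f x)\<^sup>2)" for x
    using mult_left_mono[OF _ assms(2)] by (simp add: mult.left_commute)
  \<comment> \<open>If the left integrand is not integrable, its integral is \<open>0\<close> and the right one is nonnegative.\<close>
  then have "(LINT x|N. w x * (g x)\<^sup>2) \<le> (LINT x|N. c\<^sup>2 * (w x * (f x)\<^sup>2))"
    using assms(1,2) by (intro integral_mono') auto
  then show ?thesis
    by simp
qed

lemma integral_order_stat_le:
  assumes "integrable lborel (\<lambda>x. w x * (f x)\<^sup>2)" "\<And>x. 0 \<le> w x" "\<And>x. 0 \<le> f x"
    and "\<And>x. 0 \<le> F x" "\<And>x. F x \<le> 1" "i \<in> {1..n}"
  shows "(LINT x|lborel. w x * (order_stat_pdf F f i n x)\<^sup>2)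
    \<le> (beta_peak n i)\<^sup>2 * (LINT x|lborel. w x * (f x)\<^sup>2)"
  using assms by (intro integral_weighted_square_le order_stat_pdf_nonneg order_stat_pdf_le) auto

text \<open>Regroups the constants obtained from \<open>integral_order_stat_le\<close> for \<open>m\<close> observations of rank
  \<open>i\<close> into the factors in which the bound is written.\<close>

lemma beta_peak_power:
  assumes "i \<in> {1..n}" "card A = m"
  shows "((beta_peak n i)\<^sup>2) ^ m = real n ^ (2 * m) / real (n - 1) ^ (2 * m * (n - 1))
    * (\<Prod>j\<in>A. real ((n - 1) choose (i - 1)) ^ 2 * real (i - 1) ^ (2 * i - 2)
         * real (n - i) ^ (2 * n - 2 * i))"
proof -
  have e: "2 * i - 2 = (i - 1) * 2" "2 * n - 2 * i = (n - i) * 2"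
    "2 * m * (n - 1) = (n - 1) * 2 * m"
    by auto
  show ?thesis
    unfolding beta_peak_def e prod_constant assms(2)
    by (simp add: power_mult_distrib power_divide power_mult)
qed

theorem theorem3p2:
  fixes M :: "'s measure" and X :: "'s \<Rightarrow> real"
    and f F w\<^sub>1 :: "real \<Rightarrow> real"
    and p q :: real and n a b :: nat
  assumes "prob_space M"
    and "distributed M lborel X (\<lambda>x. ennreal (f x))"
    and "\<And>x. 0 \<le> f x"
    and "F = cdf (distr M borel X)"
    and "\<And>x. 0 \<le> w\<^sub>1 x"
    and "integrable lborel (\<lambda>x. w\<^sub>1 x * (f x)\<^sup>2)"
    and "gwe w\<^sub>1 f \<noteq> 0"
    and "p \<in> {0<..<1/2} \<union> {1/2<..<1}"
    and "q = 1 - p"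
    and "a = percentile_rank p n"
    and "b = percentile_rank q n"
    and "1 \<le> n"
    and "2 \<le> n \<Longrightarrow> a \<in> {1..n} \<and> b \<in> {1..n}"
  shows "(even n \<longrightarrow>
      gwe_PRSS w\<^sub>1 F f p n / gwe_SRS w\<^sub>1 f n \<le>
        real n ^ (2 * n) / real (n - 1) ^ (2 * n * (n - 1))
        * (\<Prod>i = 1..n div 2.
             real ((n - 1) choose (a - 1)) ^ 2 * real (a - 1) ^ (2 * a - 2)
             * real (n - a) ^ (2 * n - 2 * a))
        * (\<Prod>i = n div 2 + 1..n.
             real ((n - 1) choose (b - 1)) ^ 2 * real (b - 1) ^ (2 * b - 2)
             * real (n - b) ^ (2 * n - 2 * b)))
    \<and> (odd n \<longrightarrow>
      gwe_PRSS w\<^sub>1 F f p n / gwe_SRS w\<^sub>1 f n \<le>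
        real n ^ (2 * n - 2) / real (n - 1) ^ (2 * (n - 1) ^ 2)
        * ((fact n) ^ 2 / (fact ((n - 1) div 2)) ^ 4)
        * (\<Prod>i = 1..(n - 1) div 2.
             real ((n - 1) choose (a - 1)) ^ 2 * real (a - 1) ^ (2 * a - 2)
             * real (n - a) ^ (2 * n - 2 * a))
        * (\<Prod>i = (n + 1) div 2..n - 1.
             real ((n - 1) choose (b - 1)) ^ 2 * real (b - 1) ^ (2 * b - 2)
             * real (n - b) ^ (2 * n - 2 * b)))"
proof -
  define J where "J = (LINT x|lborel. w\<^sub>1 x * (f x)\<^sup>2)"
  define I where "I = (\<lambda>i. LINT x|lborel. w\<^sub>1 x * (order_stat_pdf F f i n x)\<^sup>2)"
  define A where "A = beta_peak n a"
  define B where "B = beta_peak n b"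
  interpret prob_space M by fact
  have "X \<in> borel_measurable M"
    using assms(2) by (simp add: distributed_def)
  then interpret D: prob_space "distr M borel X"
    by (intro prob_space_distr) simp
  have F: "0 \<le> F x" "F x \<le> 1" for x
    unfolding assms(4) cdf_def by simp_all
  have w0: "0 \<le> w\<^sub>1 x" and f0: "0 \<le> f x" for x
    using assms(3,5) by auto
  have "J \<noteq> 0" "0 \<le> J"
    using assms(7) w0 by (auto simp: J_def gwe_def)
  then have J: "0 < J"
    by simp
  have I0: "0 \<le> I i" for i
    using w0 by (simp add: I_def)
  have I_le: "I i \<le> (beta_peak n i)\<^sup>2 * J" if "i \<in> {1..n}" for i
    unfolding I_def J_def by (rule integral_order_stat_le[OF assms(6) w0 f0 F that])
  have ranks: "percentile_rank p n = a" "percentile_rank (1 - p) n = b"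
    using assms(9-11) by simp_all
  have SRS: "gwe_SRS w\<^sub>1 f n = - (1/2) * J ^ n"
    by (simp add: gwe_SRS_def J_def)

  have "gwe_PRSS w\<^sub>1 F f p n / gwe_SRS w\<^sub>1 f n \<le> (A\<^sup>2) ^ (n div 2) * (B\<^sup>2) ^ (n div 2)
      \<and> a \<in> {1..n} \<and> b \<in> {1..n}" if "even n"
  proof -
    have ab: "a \<in> {1..n}" "b \<in> {1..n}"
      using that assms(12,13) by fastforce+
    have "I a ^ (n div 2) * I b ^ (n div 2) \<le> (A\<^sup>2 * J) ^ (n div 2) * (B\<^sup>2 * J) ^ (n div 2)"
      unfolding A_def B_def using I0 J by (intro mult_mono power_mono I_le ab) auto
    also have "\<dots> = (A\<^sup>2) ^ (n div 2) * (B\<^sup>2) ^ (n div 2) * J ^ (n div 2 + n div 2)"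
      by (simp add: power_mult_distrib power_add)
    also have "n div 2 + n div 2 = n"
      using that by auto
    finally have "I a ^ (n div 2) * I b ^ (n div 2) / J ^ n
        \<le> (A\<^sup>2) ^ (n div 2) * (B\<^sup>2) ^ (n div 2)"
      using J by (simp add: pos_divide_le_eq)
    moreover have "gwe_PRSS w\<^sub>1 F f p n = - (1/2) * (I a ^ (n div 2) * I b ^ (n div 2))"
      using that by (simp add: gwe_PRSS_def Let_def ranks I_def)
    ultimately show ?thesis
      using ab by (simp add: SRS)
  qed
  moreover have "(A\<^sup>2) ^ (n div 2) * (B\<^sup>2) ^ (n div 2) =
        real n ^ (2 * n) / real (n - 1) ^ (2 * n * (n - 1))
        * (\<Prod>i = 1..n div 2.
             real ((n - 1) choose (a - 1)) ^ 2 * real (a - 1) ^ (2 * a - 2)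
             * real (n - a) ^ (2 * n - 2 * a))
        * (\<Prod>i = n div 2 + 1..n.
             real ((n - 1) choose (b - 1)) ^ 2 * real (b - 1) ^ (2 * b - 2)
             * real (n - b) ^ (2 * n - 2 * b))"
    if "even n" "a \<in> {1..n}" "b \<in> {1..n}"
  proof -
    define h where "h = n div 2"
    have n: "n = h + h"
      using that(1) by (auto simp: h_def)
    have card: "card {1..h} = h" "card {h + 1..n} = h"
      using n by simp_all
    have "2 * n = 2 * h + 2 * h" "2 * n * (n - 1) = 2 * h * (n - 1) + 2 * h * (n - 1)"
      using n by (auto simp: algebra_simps)
    then show ?thesis
      unfolding A_def B_def h_def[symmetric]
        beta_peak_power[OF that(2) card(1)] beta_peak_power[OF that(3) card(2)]
      by (simp only: power_add times_divide_eq_left times_divide_eq_right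
          divide_divide_eq_left mult_ac)
  qed
  moreover have "gwe_PRSS w\<^sub>1 F f p n / gwe_SRS w\<^sub>1 f n
      \<le> (A\<^sup>2) ^ ((n - 1) div 2) * (B\<^sup>2) ^ ((n - 1) div 2)
        * ((fact n) ^ 2 / (fact ((n - 1) div 2)) ^ 4)" if "odd n"
  proof -
    define h where "h = (n - 1) div 2"
    have n: "n = h + h + 1"
      using that by (auto simp: h_def elim: oddE)
    define c :: real where "c = fact n / (fact h * fact h)"
    have med: "(n + 1) div 2 = Suc h"
      using n by simp
    have ab: "a \<in> {1..n} \<and> b \<in> {1..n}" if "h \<noteq> 0"
      using that n assms(13) by simp
    \<comment> \<open>For a sample of size one the exponent \<open>h\<close> is zero, and the ranks may lie outside the sample.\<close>
    have Ia: "I a ^ h \<le> (A\<^sup>2 * J) ^ h" and Ib: "I b ^ h \<le> (B\<^sup>2 * J) ^ h"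
      using ab I0 I_le unfolding A_def B_def by (cases "h = 0"; auto intro!: power_mono)+
    have "order_stat_pdf F f (Suc h) n x \<le> c * f x" for x
      using order_stat_pdf_le_coeff[of F x f "Suc h" n] F f0 n by (simp add: c_def)
    then have Im: "I (Suc h) \<le> c\<^sup>2 * J"
      unfolding I_def J_def
      by (intro integral_weighted_square_le[OF assms(6)] w0 order_stat_pdf_nonneg F f0)
    have "I a ^ h * I b ^ h * I (Suc h) \<le> (A\<^sup>2 * J) ^ h * (B\<^sup>2 * J) ^ h * (c\<^sup>2 * J)"
      using I0 J by (intro mult_mono Ia Ib Im) auto
    also have "\<dots> = (A\<^sup>2) ^ h * (B\<^sup>2) ^ h * c\<^sup>2 * J ^ n"
      unfolding n by (simp add: power_mult_distrib power_add)
    finally have "I a ^ h * I b ^ h * I (Suc h) / J ^ n \<le> (A\<^sup>2) ^ h * (B\<^sup>2) ^ h * c\<^sup>2"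
      using J by (simp add: pos_divide_le_eq)
    moreover have "gwe_PRSS w\<^sub>1 F f p n = - (1/2) * (I a ^ h * I b ^ h * I (Suc h))"
      unfolding gwe_PRSS_def Let_def ranks med h_def[symmetric] I_def using that by simp
    moreover have "c\<^sup>2 = (fact n) ^ 2 / (fact h) ^ 4"
      by (simp add: c_def power_divide power_mult_distrib flip: power_add)
    ultimately show ?thesis
      by (simp add: SRS h_def)
  qed
  moreover have "(A\<^sup>2) ^ ((n - 1) div 2) * (B\<^sup>2) ^ ((n - 1) div 2)
        * ((fact n) ^ 2 / (fact ((n - 1) div 2)) ^ 4) =
        real n ^ (2 * n - 2) / real (n - 1) ^ (2 * (n - 1) ^ 2)
        * ((fact n) ^ 2 / (fact ((n - 1) div 2)) ^ 4)
        * (\<Prod>i = 1..(n - 1) div 2.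
             real ((n - 1) choose (a - 1)) ^ 2 * real (a - 1) ^ (2 * a - 2)
             * real (n - a) ^ (2 * n - 2 * a))
        * (\<Prod>i = (n + 1) div 2..n - 1.
             real ((n - 1) choose (b - 1)) ^ 2 * real (b - 1) ^ (2 * b - 2)
             * real (n - b) ^ (2 * n - 2 * b))" if "odd n"
  proof (cases "n = 1")
    case True
    then show ?thesis
      by simp
  next
    case False
    define h where "h = (n - 1) div 2"
    have n: "n = h + h + 1"
      using that by (auto simp: h_def elim: oddE)
    have ab: "a \<in> {1..n}" "b \<in> {1..n}"
      using False assms(12,13) by auto
    have card: "card {1..h} = h" "card {(n + 1) div 2..n - 1} = h"
      using n by simp_all
    have "2 * n - 2 = 2 * h + 2 * h" "2 * (n - 1) ^ 2 = 2 * h * (n - 1) + 2 * h * (n - 1)"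
      using n by (auto simp: algebra_simps power2_eq_square)
    then show ?thesis
      unfolding A_def B_def h_def[symmetric]
        beta_peak_power[OF ab(1) card(1)] beta_peak_power[OF ab(2) card(2)]
      by (simp only: power_add times_divide_eq_left times_divide_eq_right
          divide_divide_eq_left mult_ac)
  qed
  ultimately show ?thesis
    by simp
qed

end
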